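(* Let $\Gamma$ be a finite sequence of implicational Horn formulas, $\phi$ a monotone formula, and $q,r$ atoms. If the sequent $\Gamma,\phi\Rightarrow q\vee r$ is valid, then there are monotone circuits $C$ and $D$ in the variables of $\phi$, of size $(|\Gamma|+|\phi|)^{O(1)}$, such that the sequents $\Gamma,\phi\Rightarrow[C]\vee[D]$, $\Gamma,[C]\Rightarrow q$ and $\Gamma,[D]\Rightarrow r$ are all valid.
   Context: Formulas are over $\{\top,\bot,\wedge,\vee,\to\}$; monotone formulas contain no implication; monotone circuits use only gates $\top,\bot,\wedge,\vee$ and $[C]$ is the formula obtained by unfolding circuit $C$. An implicational Horn formula is an atom or of the form $\bigwedge_{i=1}^k p_i\to r$ with $p_i,r$ atoms. A sequent $\Gamma\Rightarrow\Delta$ is valid if $\bigwedge\Gamma\to\bigvee\Delta$ is a classical tautology. *)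

theory Defs
  imports Main
begin

datatype (atoms: 'a) fm =
    Atom 'a
  | Top
  | Bot
  | And "'a fm" "'a fm"
  | Or "'a fm" "'a fm"
  | Imp "'a fm" "'a fm"

primrec eval :: "('a \<Rightarrow> bool) \<Rightarrow> 'a fm \<Rightarrow> bool" where
  "eval v (Atom p) = v p"
| "eval v Top = True"
| "eval v Bot = False"
| "eval v (And A B) = (eval v A \<and> eval v B)"
| "eval v (Or A B) = (eval v A \<or> eval v B)"
| "eval v (Imp A B) = (eval v A \<longrightarrow> eval v B)"

definition tautology :: "'a fm \<Rightarrow> bool" where
  "tautology A \<longleftrightarrow> (\<forall>v. eval v A)"

text \<open>The number of occurrences of atoms, constants and connectives. (The \<open>size\<close> function generated
  by the datatype package gives leaves size 0.)\<close>

primrec fm_size :: "'a fm \<Rightarrow> nat" where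
  "fm_size (Atom p) = 1"
| "fm_size Top = 1"
| "fm_size Bot = 1"
| "fm_size (And A B) = fm_size A + fm_size B + 1"
| "fm_size (Or A B) = fm_size A + fm_size B + 1"
| "fm_size (Imp A B) = fm_size A + fm_size B + 1"

definition seq_size :: "'a fm list \<Rightarrow> nat" where
  "seq_size \<Gamma> = (\<Sum>A\<leftarrow>\<Gamma>. fm_size A)"

primrec monotone_fm :: "'a fm \<Rightarrow> bool" where
  "monotone_fm (Atom p) = True"
| "monotone_fm Top = True"
| "monotone_fm Bot = True"
| "monotone_fm (And A B) = (monotone_fm A \<and> monotone_fm B)"
| "monotone_fm (Or A B) = (monotone_fm A \<and> monotone_fm B)"
| "monotone_fm (Imp A B) = False"

fun BigAnd :: "'a fm list \<Rightarrow> 'a fm" where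
  "BigAnd [] = Top"
| "BigAnd [A] = A"
| "BigAnd (A # B # As) = And A (BigAnd (B # As))"

fun BigOr :: "'a fm list \<Rightarrow> 'a fm" where
  "BigOr [] = Bot"
| "BigOr [A] = A"
| "BigOr (A # B # As) = Or A (BigOr (B # As))"

text \<open>The list of premises may be empty, in which case the formula is \<open>Imp Top (Atom r)\<close>.\<close>

definition implicational_horn :: "'a fm \<Rightarrow> bool" where
  "implicational_horn A \<longleftrightarrow>
     (\<exists>p. A = Atom p) \<or> (\<exists>ps r. A = Imp (BigAnd (map Atom ps)) (Atom r))"

definition valid_sequent :: "'a fm list \<Rightarrow> 'a fm list \<Rightarrow> bool" where
  "valid_sequent \<Gamma> \<Delta> \<longleftrightarrow> tautology (Imp (BigAnd \<Gamma>) (BigOr \<Delta>))"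

text \<open>A monotone circuit is a topologically ordered list of nodes: a gate refers to its two inputs
  by their positions in the list, which must precede its own. The last node is the output.\<close>

datatype (gate_vars: 'a) gate =
    VarG 'a
  | TopG
  | BotG
  | AndG nat nat
  | OrG nat nat

type_synonym 'a circuit = "'a gate list"

primrec gate_inputs :: "'a gate \<Rightarrow> nat set" where
  "gate_inputs (VarG p) = {}"
| "gate_inputs TopG = {}"
| "gate_inputs BotG = {}"
| "gate_inputs (AndG j k) = {j, k}"
| "gate_inputs (OrG j k) = {j, k}"

definition monotone_circuit :: "'a circuit \<Rightarrow> bool" where
  "monotone_circuit C \<longleftrightarrow> C \<noteq> [] \<and> (\<forall>i < length C. \<forall>j \<in> gate_inputs (C ! i). j < i)"

definition circuit_vars :: "'a circuit \<Rightarrow> 'a set" where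
  "circuit_vars C = (\<Union>g \<in> set C. gate_vars g)"

definition circuit_size :: "'a circuit \<Rightarrow> nat" where
  "circuit_size C = length C"

text \<open>The guards \<open>j < i \<and> k < i\<close> only serve termination: they always hold when
  \<open>monotone_circuit C\<close> and \<open>i < length C\<close>.\<close>

fun unfold_node :: "'a circuit \<Rightarrow> nat \<Rightarrow> 'a fm" where
  "unfold_node C i =
     (case C ! i of
        VarG p \<Rightarrow> Atom p
      | TopG \<Rightarrow> Top
      | BotG \<Rightarrow> Bot
      | AndG j k \<Rightarrow>
          (if j < i \<and> k < i then And (unfold_node C j) (unfold_node C k) else Bot)
      | OrG j k \<Rightarrow>
          (if j < i \<and> k < i then Or (unfold_node C j) (unfold_node C k) else Bot))"

declare unfold_node.simps [simp del]

definition circuit_fm :: "'a circuit \<Rightarrow> 'a fm" where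
  "circuit_fm C = unfold_node C (length C - 1)"

end

theory Submission
  imports Defs
begin

text \<open>
  For a valuation \<open>v\<close> let \<open>M v\<close> be the least model of \<open>\<Gamma>\<close> containing the atoms of \<open>\<phi>\<close> that are
  true under \<open>v\<close>. The circuits \<open>C\<close> and \<open>D\<close> decide \<open>q \<in> M v\<close> and \<open>r \<in> M v\<close>.
  If \<open>v\<close> satisfies \<open>\<Gamma>\<close>, then every element of \<open>M v\<close> is true under \<open>v\<close>, so \<open>\<Gamma>, [C] \<Rightarrow> q\<close> and
  \<open>\<Gamma>, [D] \<Rightarrow> r\<close> are valid. If moreover \<open>v\<close> satisfies \<open>\<phi>\<close>, then \<open>M v\<close> is a model of \<open>\<Gamma>\<close> and, by
  monotonicity, of \<open>\<phi>\<close>, so it contains \<open>q\<close> or \<open>r\<close>. Forward chaining computes \<open>M v\<close> in at most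
  \<open>|\<Gamma>|\<close> passes over \<open>\<Gamma>\<close>, because every pass before saturation adds the head of a clause.
\<close>

section \<open>Evaluation, monotonicity and sizes of formulas\<close>

lemma eval_BigAnd: "eval v (BigAnd As) \<longleftrightarrow> (\<forall>A \<in> set As. eval v A)"
  by (induction As rule: BigAnd.induct) auto

lemma valid_sequent_single:
  "valid_sequent (\<Gamma> @ [A]) [B] \<longleftrightarrow>
     (\<forall>v. (\<forall>G \<in> set \<Gamma>. eval v G) \<longrightarrow> eval v A \<longrightarrow> eval v B)"
  by (auto simp: valid_sequent_def tautology_def eval_BigAnd)

text \<open>Used to move truth of the monotone formula from a valuation to the forward chaining
  closure of its true atoms. Only atoms of \<open>A\<close> are compared, since the closure is
  started from these alone.\<close>

lemma eval_monotone_fm: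
  assumes "monotone_fm A" "\<And>a. a \<in> atoms A \<Longrightarrow> v a \<Longrightarrow> w a" "eval v A"
  shows "eval w A"
  using assms by (induction A) auto

lemma atoms_list: "\<exists>xs. set xs = atoms A \<and> length xs \<le> fm_size A"
proof (induction A)
  case (Atom p)
  show ?case by (rule exI[of _ "[p]"]) simp
next
  case (And A B)
  then obtain xs ys where "set xs = atoms A" "length xs \<le> fm_size A"
    "set ys = atoms B" "length ys \<le> fm_size B" by blast
  then show ?case by (intro exI[of _ "xs @ ys"]) simp
next
  case (Or A B)
  then obtain xs ys where "set xs = atoms A" "length xs \<le> fm_size A"
    "set ys = atoms B" "length ys \<le> fm_size B" by blast
  then show ?case by (intro exI[of _ "xs @ ys"]) simp
next
  case (Imp A B)
  then obtain xs ys where "set xs = atoms A" "length xs \<le> fm_size A"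
    "set ys = atoms B" "length ys \<le> fm_size B" by blast
  then show ?case by (intro exI[of _ "xs @ ys"]) simp
qed simp_all

lemma fm_size_pos: "fm_size A > 0"
  by (induction A) auto

lemma length_le_seq_size: "length \<Gamma> \<le> seq_size \<Gamma>"
proof (induction \<Gamma>)
  case (Cons A \<Gamma>)
  then show ?case using fm_size_pos[of A] by (simp add: seq_size_def)
qed simp

section \<open>Forward chaining\<close>

text \<open>The pair \<open>(ps, r)\<close> stands for the clause \<open>\<And>ps \<rightarrow> r\<close>.\<close>

type_synonym 'a clause = "'a list \<times> 'a"

text \<open>A pass is \<open>fold fire cs\<close>: each clause already sees the heads added earlier
  in the same pass.\<close>

definition fire :: "'a clause \<Rightarrow> 'a set \<Rightarrow> 'a set" where
  "fire c X = (if set (fst c) \<subseteq> X then insert (snd c) X else X)"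

definition closed_under :: "'a clause list \<Rightarrow> 'a set \<Rightarrow> bool" where
  "closed_under cs X \<longleftrightarrow> (\<forall>c \<in> set cs. set (fst c) \<subseteq> X \<longrightarrow> snd c \<in> X)"

lemma fold_fire_increasing: "X \<subseteq> fold fire cs X"
proof (induction cs arbitrary: X)
  case (Cons c cs)
  have "X \<subseteq> fire c X" by (auto simp: fire_def)
  then show ?case using Cons[of "fire c X"] by auto
qed simp

lemma fold_fire_le_heads: "fold fire cs X \<subseteq> X \<union> snd ` set cs"
proof (induction cs arbitrary: X)
  case (Cons c cs)
  have "fire c X \<subseteq> insert (snd c) X" by (auto simp: fire_def)
  then show ?case using Cons[of "fire c X"] by auto
qed simp

lemma fold_fire_le_closed:
  assumes "closed_under cs Y" "X \<subseteq> Y"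
  shows "fold fire cs X \<subseteq> Y"
  using assms
proof (induction cs arbitrary: X)
  case (Cons c cs)
  have "fire c X \<subseteq> Y" "closed_under cs Y"
    using Cons.prems by (auto simp: fire_def closed_under_def)
  then show ?case using Cons.IH by simp
qed simp

text \<open>Firing never removes atoms, so an atom added by one clause would survive to the end of
  the pass. A pass without effect therefore has no single effective firing.\<close>

lemma closed_under_if_fold_fire_fixed:
  assumes "fold fire cs X = X"
  shows "closed_under cs X"
  using assms
proof (induction cs)
  case (Cons c cs)
  have "fire c X \<subseteq> X" using fold_fire_increasing[of "fire c X" cs] Cons.prems by simp
  moreover have "X \<subseteq> fire c X" by (auto simp: fire_def)
  ultimately have "fire c X = X" by blast
  then show ?case using Cons by (auto simp: closed_under_def fire_def split: if_splits)
qed (simp add: closed_under_def)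

text \<open>The measure is the number of heads missing from \<open>X\<close>. A pass that changes
  \<open>X\<close> adds only heads, so the measure drops.\<close>

lemma funpow_fold_fire_fixed:
  assumes "card (snd ` set cs - X) \<le> n"
  shows "fold fire cs ((fold fire cs ^^ n) X) = (fold fire cs ^^ n) X"
  using assms
proof (induction n arbitrary: X)
  case 0
  then have "snd ` set cs \<subseteq> X" by simp
  then show ?case using fold_fire_increasing[of X cs] fold_fire_le_heads[of cs X]
    by (simp add: subset_antisym Un_absorb2)
next
  case (Suc n)
  show ?case
  proof (cases "fold fire cs X = X")
    case True
    have "(fold fire cs ^^ k) X = X" for k by (induction k) (simp_all add: True)
    then show ?thesis using True by simp
  next
    case False
    then have "snd ` set cs - fold fire cs X \<subset> snd ` set cs - X"
      using fold_fire_increasing[of X cs] fold_fire_le_heads[of cs X] by blast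
    then have "card (snd ` set cs - fold fire cs X) < card (snd ` set cs - X)"
      by (intro psubset_card_mono) auto
    \<comment> \<open>The first of the \<open>Suc n\<close> passes is split off, so that the
      induction hypothesis applies to \<open>fold fire cs X\<close>.\<close>
    then show ?thesis using Suc by (simp add: funpow_swap1)
  qed
qed

text \<open>The number of passes is fixed in advance, independently of \<open>X\<close>, so that one
  circuit can perform them for every valuation.\<close>

definition saturate :: "'a clause list \<Rightarrow> 'a set \<Rightarrow> 'a set" where
  "saturate cs = (fold fire cs ^^ length cs)"

lemma saturate_increasing: "X \<subseteq> saturate cs X"
proof -
  have "X \<subseteq> (fold fire cs ^^ n) X" for n
  proof (induction n)
    case (Suc n)
    then show ?case using fold_fire_increasing[of "(fold fire cs ^^ n) X" cs] by simp
  qed simp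
  then show ?thesis by (simp add: saturate_def)
qed

lemma saturate_le_closed:
  assumes "closed_under cs Y" "X \<subseteq> Y"
  shows "saturate cs X \<subseteq> Y"
proof -
  have "(fold fire cs ^^ n) X \<subseteq> Y" for n
    by (induction n) (simp_all add: assms fold_fire_le_closed)
  then show ?thesis by (simp add: saturate_def)
qed

text \<open>There are at most \<open>length cs\<close> distinct heads. With
  \<open>saturate_increasing\<close> and \<open>saturate_le_closed\<close> this makes
  \<open>saturate cs X\<close> the least closed superset of \<open>X\<close>.\<close>

lemma closed_under_saturate: "closed_under cs (saturate cs X)"
proof -
  have "card (snd ` set cs - X) \<le> card (snd ` set cs)" by (intro card_mono) auto
  also have "\<dots> \<le> length cs"
    by (metis card_length length_map set_map)
  finally show ?thesis
    unfolding saturate_def by (intro closed_under_if_fold_fire_fixed funpow_fold_fire_fixed)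
qed

section \<open>Translation of Horn formulas into clauses\<close>

lemma implicational_horn_clause:
  assumes "implicational_horn A"
  shows "\<exists>c. (\<forall>v. eval v A \<longleftrightarrow> closed_under [c] (Collect v)) \<and> length (fst c) < fm_size A"
proof -
  have size: "length ps \<le> fm_size (BigAnd (map Atom ps))" for ps :: "'a list"
    by (induction ps rule: induct_list012) auto
  from assms consider p where "A = Atom p"
    | ps r where "A = Imp (BigAnd (map Atom ps)) (Atom r)"
    by (auto simp: implicational_horn_def)
  then show ?thesis
  proof cases
    case 1
    \<comment> \<open>An atom is a clause with empty body.\<close>
    then show ?thesis by (intro exI[of _ "([], p)"]) (simp add: closed_under_def)
  next
    case 2
    then show ?thesis using size[of ps]
      by (intro exI[of _ "(ps, r)"]) (auto simp: closed_under_def eval_BigAnd)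
  qed
qed

text \<open>The summand \<open>length (fst c) + 2\<close> is the number of gates that firing
  \<open>c\<close> will cost in \<open>carries_fire\<close>.\<close>

lemma horn_clause_list:
  assumes "\<forall>A \<in> set \<Gamma>. implicational_horn A"
  shows "\<exists>cs. length cs = length \<Gamma> \<and>
    (\<forall>v. (\<forall>A \<in> set \<Gamma>. eval v A) \<longleftrightarrow> closed_under cs (Collect v)) \<and>
    (\<Sum>c\<leftarrow>cs. length (fst c) + 2) \<le> 2 * seq_size \<Gamma>"
  using assms
proof (induction \<Gamma>)
  case Nil
  then show ?case by (simp add: closed_under_def)
next
  case (Cons A \<Gamma>)
  then obtain cs where cs: "length cs = length \<Gamma>"
    "\<And>v. (\<forall>A \<in> set \<Gamma>. eval v A) \<longleftrightarrow> closed_under cs (Collect v)"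
    "(\<Sum>c\<leftarrow>cs. length (fst c) + 2) \<le> 2 * seq_size \<Gamma>" by auto
  obtain c where c: "\<And>v. eval v A \<longleftrightarrow> closed_under [c] (Collect v)" "length (fst c) < fm_size A"
    using implicational_horn_clause Cons.prems by (metis list.set_intros(1))
  have "length (fst c) + 2 \<le> 2 * fm_size A" using c(2) by simp
  moreover have "(\<forall>B \<in> set (A # \<Gamma>). eval v B) \<longleftrightarrow> closed_under (c # cs) (Collect v)" for v
    using cs(2)[of v] c(1)[of v] by (simp add: closed_under_def)
  ultimately show ?case using cs(1,3)
    by (intro exI[of _ "c # cs"]) (simp add: seq_size_def)
qed

section \<open>Circuits that carry a set of atoms\<close>

text \<open>Gates point backwards only, so circuits can be extended at the end without disturbing
  the nodes already built.\<close>

lemma unfold_node_append: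
  assumes "monotone_circuit C" "i < length C"
  shows "unfold_node (C @ E) i = unfold_node C i"
  using assms(2)
proof (induction i rule: less_induct)
  case (less i)
  then have "\<forall>j \<in> gate_inputs (C ! i). j < i" using assms(1) by (simp add: monotone_circuit_def)
  then show ?case using less
    by (subst (1 2) unfold_node.simps) (auto simp: nth_append split: gate.split)
qed

lemma monotone_circuit_snoc:
  assumes "monotone_circuit C" "\<forall>j \<in> gate_inputs g. j < length C"
  shows "monotone_circuit (C @ [g])"
  using assms by (auto simp: monotone_circuit_def nth_append less_Suc_eq)

lemma circuit_vars_snoc: "circuit_vars (C @ [g]) = circuit_vars C \<union> gate_vars g"
  by (auto simp: circuit_vars_def)

text \<open>One shared circuit computes the whole set \<open>F v\<close>: node \<open>m a\<close>
  decides whether \<open>a\<close> belongs to it. As \<open>m\<close> is total, atoms that never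
  occur also need a node.\<close>

definition carries :: "'a circuit \<Rightarrow> ('a \<Rightarrow> nat) \<Rightarrow> (('a \<Rightarrow> bool) \<Rightarrow> 'a set) \<Rightarrow> bool" where
  "carries C m F \<longleftrightarrow> monotone_circuit C \<and>
     (\<forall>a. m a < length C \<and> (\<forall>v. eval v (unfold_node C (m a)) \<longleftrightarrow> a \<in> F v))"

lemma carries_snoc:
  assumes "carries C m F" "\<forall>j \<in> gate_inputs g. j < length C"
  shows "carries (C @ [g]) m F"
  using assms by (auto simp: carries_def monotone_circuit_snoc unfold_node_append less_SucI)

text \<open>Updating the set at \<open>a\<close> only redirects the pointer of \<open>a\<close>;
  every other atom keeps its node.\<close>

lemma carries_upd:
  assumes "carries C m F" "i < length C" "\<And>v. eval v (unfold_node C i) \<longleftrightarrow> P v"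
  shows "carries C (m(a := i)) (\<lambda>v. if P v then insert a (F v) else F v - {a})"
  using assms by (auto simp: carries_def)

lemma carries_atoms:
  "\<exists>C m. carries C m (\<lambda>v. {a \<in> set xs. v a}) \<and> circuit_vars C \<subseteq> set xs \<and>
     length C = length xs + 1"
proof (induction xs)
  case Nil
  \<comment> \<open>Node 0 is constantly false and is the default for every atom outside the list;
    it accounts for the \<open>+ 1\<close> in the length.\<close>
  have "carries [BotG] (\<lambda>_. 0) (\<lambda>v. {a \<in> set []. v a})"
    by (simp add: carries_def monotone_circuit_def unfold_node.simps)
  then show ?case by (intro exI[of _ "[BotG]"]) (auto simp: circuit_vars_def)
next
  case (Cons x xs)
  then obtain C m where C: "carries C m (\<lambda>v. {a \<in> set xs. v a})" "circuit_vars C \<subseteq> set xs"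
    "length C = length xs + 1" by blast
  let ?C = "C @ [VarG x]"
  have "carries ?C m (\<lambda>v. {a \<in> set xs. v a})" using C(1) by (simp add: carries_snoc)
  then have "carries ?C (m(x := length C))
    (\<lambda>v. if v x then insert x {a \<in> set xs. v a} else {a \<in> set xs. v a} - {x})"
    by (rule carries_upd) (simp_all add: unfold_node.simps)
  also have "(\<lambda>v. if v x then insert x {a \<in> set xs. v a} else {a \<in> set xs. v a} - {x}) =
    (\<lambda>v. {a \<in> set (x # xs). v a})" by (auto simp: fun_eq_iff)
  finally show ?case using C(2,3)
    by (intro exI[of _ ?C] exI[of _ "m(x := length C)"]) (auto simp: circuit_vars_snoc)
qed

lemma carries_conjunction:
  assumes "carries C m F"
  shows "\<exists>C'. carries C' m F \<and> circuit_vars C' = circuit_vars C \<and>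
    length C' = length C + length ps + 1 \<and>
    (\<forall>v. eval v (unfold_node C' (length C' - 1)) \<longleftrightarrow> set ps \<subseteq> F v)"
proof (induction ps)
  case Nil
  have "carries (C @ [TopG]) m F" using assms by (simp add: carries_snoc)
  then show ?case
    by (intro exI[of _ "C @ [TopG]"]) (simp add: circuit_vars_snoc unfold_node.simps)
next
  case (Cons p ps)
  then obtain C' where C': "carries C' m F" "circuit_vars C' = circuit_vars C"
    "length C' = length C + length ps + 1"
    "\<And>v. eval v (unfold_node C' (length C' - 1)) \<longleftrightarrow> set ps \<subseteq> F v" by auto
  \<comment> \<open>The last node of \<open>C'\<close> holds the conjunction for \<open>ps\<close>.
    The chain starts at a \<open>TopG\<close>, so a body of length \<open>n\<close> costs
    \<open>n + 1\<close> gates.\<close>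
  let ?E = "C' @ [AndG (m p) (length C' - 1)]"
  have mp: "monotone_circuit C'" "m p < length C'" "\<And>v. eval v (unfold_node C' (m p)) \<longleftrightarrow> p \<in> F v"
    using C'(1) by (auto simp: carries_def)
  have "carries ?E m F" using C'(1,3) mp by (intro carries_snoc) auto
  moreover have "eval v (unfold_node ?E (length ?E - 1)) \<longleftrightarrow> set (p # ps) \<subseteq> F v" for v
    using mp C'(4)[of v]
    by (subst unfold_node.simps) (auto simp: unfold_node_append)
  ultimately show ?case using C'(2,3)
    by (intro exI[of _ ?E]) (simp add: circuit_vars_snoc)
qed

lemma carries_fire:
  assumes "carries C m F"
  shows "\<exists>C' m'. carries C' m' (\<lambda>v. fire c (F v)) \<and> circuit_vars C' = circuit_vars C \<and>
    length C' = length C + (length (fst c) + 2)"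
proof -
  obtain E where E: "carries E m F" "circuit_vars E = circuit_vars C"
    "length E = length C + length (fst c) + 1"
    "\<And>v. eval v (unfold_node E (length E - 1)) \<longleftrightarrow> set (fst c) \<subseteq> F v"
    using carries_conjunction[OF assms] by metis
  let ?r = "snd c"
  \<comment> \<open>After firing, the head holds if it held before or the body holds; the new gate
    becomes the node of the head.\<close>
  let ?C = "E @ [OrG (m ?r) (length E - 1)]"
  have mr: "monotone_circuit E" "m ?r < length E"
    "\<And>v. eval v (unfold_node E (m ?r)) \<longleftrightarrow> ?r \<in> F v"
    using E(1) by (auto simp: carries_def)
  have "carries ?C m F" using E(1,3) mr by (intro carries_snoc) auto
  moreover have "eval v (unfold_node ?C (length E)) \<longleftrightarrow> ?r \<in> F v \<or> set (fst c) \<subseteq> F v" for v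
    using mr E(4)[of v] by (subst unfold_node.simps) (auto simp: unfold_node_append)
  ultimately have "carries ?C (m(?r := length E))
    (\<lambda>v. if ?r \<in> F v \<or> set (fst c) \<subseteq> F v then insert ?r (F v) else F v - {?r})"
    by (intro carries_upd) auto
  \<comment> \<open>Removing \<open>?r\<close> in the negative case changes nothing, because
    \<open>?r\<close> is not in \<open>F v\<close> there.\<close>
  also have "(\<lambda>v. if ?r \<in> F v \<or> set (fst c) \<subseteq> F v then insert ?r (F v) else F v - {?r}) =
    (\<lambda>v. fire c (F v))" by (auto simp: fun_eq_iff fire_def)
  finally have "carries ?C (m(?r := length E)) (\<lambda>v. fire c (F v))" .
  moreover have "circuit_vars ?C = circuit_vars C" "length ?C = length C + (length (fst c) + 2)"
    using E(2,3) by (simp_all add: circuit_vars_snoc)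
  ultimately show ?thesis by blast
qed

lemma carries_fold_fire:
  assumes "carries C m F"
  shows "\<exists>C' m'. carries C' m' (\<lambda>v. fold fire cs (F v)) \<and> circuit_vars C' = circuit_vars C \<and>
    length C' = length C + (\<Sum>c\<leftarrow>cs. length (fst c) + 2)"
  using assms
proof (induction cs arbitrary: C m F)
  case Nil
  then show ?case by auto
next
  case (Cons c cs)
  obtain E n where E: "carries E n (\<lambda>v. fire c (F v))" "circuit_vars E = circuit_vars C"
    "length E = length C + (length (fst c) + 2)"
    using carries_fire[OF Cons.prems] by blast
  show ?case using Cons.IH[OF E(1)] E(2,3) by (simp add: add.assoc)
qed

text \<open>Each pass is appended to the same circuit and reuses its nodes, so the size grows by a
  fixed amount per pass.\<close>

lemma carries_funpow_fold_fire:
  assumes "carries C m F"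
  shows "\<exists>C' m'. carries C' m' (\<lambda>v. (fold fire cs ^^ n) (F v)) \<and>
    circuit_vars C' = circuit_vars C \<and>
    length C' = length C + n * (\<Sum>c\<leftarrow>cs. length (fst c) + 2)"
proof (induction n)
  case 0
  then show ?case using assms by auto
next
  case (Suc n)
  then obtain E l where E: "carries E l (\<lambda>v. (fold fire cs ^^ n) (F v))"
    "circuit_vars E = circuit_vars C"
    "length E = length C + n * (\<Sum>c\<leftarrow>cs. length (fst c) + 2)" by blast
  show ?case using carries_fold_fire[OF E(1), of cs] E(2,3) by (simp add: algebra_simps)
qed

lemma carries_output:
  assumes "carries C m F"
  shows "\<exists>C'. monotone_circuit C' \<and> circuit_vars C' = circuit_vars C \<and>
    circuit_size C' = length C + 1 \<and> (\<forall>v. eval v (circuit_fm C') \<longleftrightarrow> a \<in> F v)"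
proof -
  \<comment> \<open>The output of a circuit is its last node, so the node of \<open>a\<close> is
    copied there by an idempotent disjunction.\<close>
  let ?C = "C @ [OrG (m a) (m a)]"
  have ma: "monotone_circuit C" "m a < length C" "\<And>v. eval v (unfold_node C (m a)) \<longleftrightarrow> a \<in> F v"
    using assms by (auto simp: carries_def)
  have "eval v (circuit_fm ?C) \<longleftrightarrow> a \<in> F v" for v
    using ma unfolding circuit_fm_def
    by (subst unfold_node.simps) (auto simp: unfold_node_append)
  moreover have "monotone_circuit ?C" using ma by (intro monotone_circuit_snoc) auto
  ultimately show ?thesis
    by (intro exI[of _ ?C]) (simp add: circuit_vars_snoc circuit_size_def)
qed

section \<open>The two circuits and their quadratic size bound\<close>

theorem theorem7p7:
  "\<exists>c k :: nat. \<forall>(\<Gamma> :: 'a fm list) (\<phi> :: 'a fm) (q :: 'a) (r :: 'a).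
     (\<forall>A \<in> set \<Gamma>. implicational_horn A) \<longrightarrow>
     monotone_fm \<phi> \<longrightarrow>
     valid_sequent (\<Gamma> @ [\<phi>]) [Or (Atom q) (Atom r)] \<longrightarrow>
     (\<exists>C D :: 'a circuit.
        monotone_circuit C \<and> monotone_circuit D \<and>
        circuit_vars C \<subseteq> atoms \<phi> \<and> circuit_vars D \<subseteq> atoms \<phi> \<and>
        circuit_size C \<le> c * (seq_size \<Gamma> + fm_size \<phi>) ^ k \<and>
        circuit_size D \<le> c * (seq_size \<Gamma> + fm_size \<phi>) ^ k \<and>
        valid_sequent (\<Gamma> @ [\<phi>]) [Or (circuit_fm C) (circuit_fm D)] \<and>
        valid_sequent (\<Gamma> @ [circuit_fm C]) [Atom q] \<and>
        valid_sequent (\<Gamma> @ [circuit_fm D]) [Atom r])"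
proof (rule exI[of _ 4], rule exI[of _ 2], intro allI impI)
  fix \<Gamma> :: "'a fm list" and \<phi> :: "'a fm" and q r :: 'a
  assume horn: "\<forall>A \<in> set \<Gamma>. implicational_horn A"
    and mono: "monotone_fm \<phi>"
    and valid: "valid_sequent (\<Gamma> @ [\<phi>]) [Or (Atom q) (Atom r)]"
  obtain cs where cs: "length cs = length \<Gamma>"
    "\<And>v. (\<forall>A \<in> set \<Gamma>. eval v A) \<longleftrightarrow> closed_under cs (Collect v)"
    "(\<Sum>c\<leftarrow>cs. length (fst c) + 2) \<le> 2 * seq_size \<Gamma>"
    using horn_clause_list[OF horn] by blast
  obtain xs where xs: "set xs = atoms \<phi>" "length xs \<le> fm_size \<phi>"
    using atoms_list[of \<phi>] by blast
  define M where "M = (\<lambda>v. saturate cs {a \<in> atoms \<phi>. v a})"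
  obtain B m where B: "carries B m (\<lambda>v. {a \<in> atoms \<phi>. v a})" "circuit_vars B \<subseteq> atoms \<phi>"
    "length B = length xs + 1"
    using carries_atoms[of xs] xs(1) by auto
  obtain E l where E: "carries E l M" "circuit_vars E = circuit_vars B"
    "length E = length B + length cs * (\<Sum>c\<leftarrow>cs. length (fst c) + 2)"
    using carries_funpow_fold_fire[OF B(1), of "length cs" cs]
    unfolding M_def saturate_def by blast
  obtain C where C: "monotone_circuit C" "circuit_vars C = circuit_vars E"
    "circuit_size C = length E + 1" "\<And>v. eval v (circuit_fm C) \<longleftrightarrow> q \<in> M v"
    using carries_output[OF E(1), of q] by blast
  obtain D where D: "monotone_circuit D" "circuit_vars D = circuit_vars E"
    "circuit_size D = length E + 1" "\<And>v. eval v (circuit_fm D) \<longleftrightarrow> r \<in> M v"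
    using carries_output[OF E(1), of r] by blast
  have size: "length E + 1 \<le> 4 * (seq_size \<Gamma> + fm_size \<phi>) ^ 2"
  proof -
    let ?s = "seq_size \<Gamma>" and ?f = "fm_size \<phi>"
    have "length cs * (\<Sum>c\<leftarrow>cs. length (fst c) + 2) \<le> ?s * (2 * ?s)"
      using cs(1,3) length_le_seq_size[of \<Gamma>] by (intro mult_mono) auto
    \<comment> \<open>The 2 counts the \<open>BotG\<close> and the output gate, \<open>?f\<close>
      bounds the variable gates, and the square bounds at most \<open>?s\<close> passes of at most
      \<open>2 * ?s\<close> gates each.\<close>
    then have "length E + 1 \<le> 2 + ?f + 2 * ?s ^ 2"
      using E(3) B(3) xs(2) by (simp add: power2_eq_square)
    moreover have "?f \<le> ?f ^ 2" "1 \<le> ?f ^ 2"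
      using fm_size_pos[of \<phi>] by (simp_all add: power2_eq_square)
    moreover have "?s ^ 2 + ?f ^ 2 \<le> (?s + ?f) ^ 2" by (simp add: power2_sum)
    ultimately show ?thesis by linarith
  qed
  \<comment> \<open>If \<open>v\<close> satisfies \<open>\<Gamma>\<close>, then
    \<open>Collect v\<close> is closed and contains the starting atoms, hence contains the least
    such set \<open>M v\<close>.\<close>
  have sound: "v a" if "\<forall>A \<in> set \<Gamma>. eval v A" "a \<in> M v" for v a
    using that saturate_le_closed[of cs "Collect v" "{a \<in> atoms \<phi>. v a}"] cs(2)[of v]
    by (auto simp: M_def)
  have complete: "q \<in> M v \<or> r \<in> M v" if "eval v \<phi>" for v
  proof -
    \<comment> \<open>The assumed validity will be applied to membership in \<open>M v\<close> as a
      valuation; \<open>cs(2)\<close> at this valuation turns closedness into truth of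
      \<open>\<Gamma>\<close>.\<close>
    have "\<forall>A \<in> set \<Gamma>. eval (\<lambda>a. a \<in> M v) A"
      using cs(2) closed_under_saturate by (simp add: M_def)
    moreover have "eval (\<lambda>a. a \<in> M v) \<phi>"
    proof (rule eval_monotone_fm[OF mono _ that])
      fix a assume "a \<in> atoms \<phi>" "v a"
      then show "a \<in> M v" using saturate_increasing[of "{a \<in> atoms \<phi>. v a}" cs]
        by (auto simp: M_def)
    qed
    ultimately show ?thesis using valid by (auto simp: valid_sequent_single)
  qed
  show "\<exists>C D :: 'a circuit.
        monotone_circuit C \<and> monotone_circuit D \<and>
        circuit_vars C \<subseteq> atoms \<phi> \<and> circuit_vars D \<subseteq> atoms \<phi> \<and>
        circuit_size C \<le> 4 * (seq_size \<Gamma> + fm_size \<phi>) ^ 2 \<and>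
        circuit_size D \<le> 4 * (seq_size \<Gamma> + fm_size \<phi>) ^ 2 \<and>
        valid_sequent (\<Gamma> @ [\<phi>]) [Or (circuit_fm C) (circuit_fm D)] \<and>
        valid_sequent (\<Gamma> @ [circuit_fm C]) [Atom q] \<and>
        valid_sequent (\<Gamma> @ [circuit_fm D]) [Atom r]"
    using C D E(2) B(2) size sound complete
    by (intro exI[of _ C] exI[of _ D]) (auto simp: valid_sequent_single)
qed

end
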